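(* For every odd $n\ge 1$, there is an automaton $\mathcal{A}_n$ with $n$ states and two observable events, for which Algorithm 1 (semigroup-based IFO verification) runs in time $\Omega\big(n^2\, 2^{(n^2-1)/4}\big)$.
   Context: An automaton is a triple $\mathcal{A}=(Q,\Sigma,\delta)$ with a finite state set $Q$, a finite nonempty alphabet $\Sigma$ (events), and $\delta\colon Q\times\Sigma\to 2^Q$, extended to $2^Q\times\Sigma^*$ as usual. The alphabet is partitioned into observable events $\Sigma_o$ and unobservable events; $P\colon\Sigma^*\to\Sigma_o^*$ is the morphism erasing the unobservable events. For $s,t\in Q$, $L_m(\mathcal{A},s,t)=\{w\in\Sigma^*\mid t\in\delta(s,w)\}$. IFO: $\mathcal{A}$ is initial-and-final-state opaque (IFO) with respect to sets $Q_S,Q_{NS}\subseteq Q\times Q$ of secret and nonsecret pairs and $P$ if for every $(s,t)\in Q_S$ and every $w\in L_m(\mathcal{A},s,t)$ there are $(s',t')\in Q_{NS}$ and $w'\in L_m(\mathcal{A},s',t')$ with $P(w)=P(w')$. Projected automaton: $P(\mathcal{A})$ is the automaton over $\Sigma_o$ with the same states as $\mathcal{A}$, obtained by replacing each transition $(q,a,r)$ by $(q,P(a),r)$ and eliminating $\varepsilon$-transitions. Semigroup: for an automaton with $n$ states, each event $a$ defines the $n\times n$ binary matrix $(a_{ij})$ with $a_{ij}=1$ iff $j\in\delta(i,a)$. $\mathcal{B}_{\mathcal{A}}$ is the semigroup of all finite products of the matrices of the events under boolean matrix multiplication (addition replaced by maximum). Algorithm 1 (input: $\mathcal{A}$, $Q_S,Q_{NS}\subseteq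 Q\times Q$, $\Sigma_o\subseteq\Sigma$; output: true iff $\mathcal{A}$ is IFO with respect to $Q_S$, $Q_{NS}$, $P$): construct $P(\mathcal{A})$; compute the elements of $\mathcal{B}_{P(\mathcal{A})}$ one by one; for every newly generated element $(w_{ij})$ and every $(s,f)\in Q_S$, if $w_{sf}=1$ and there is no $(s',f')\in Q_{NS}$ with $w_{s'f'}=1$, return false; after all elements have been processed, return true. $f(n)\in\Omega(g(n))$ means $g(n)\in O(f(n))$. *)

theory Defs
  imports Complex_Main "HOL-Library.Landau_Symbols"
begin

section \<open>Automata and projections\<close>

record ('s, 'e) automaton =
  states :: "'s set"
  events :: "'e set"
  trans :: "'s \<Rightarrow> 'e \<Rightarrow> 's set"

definition is_automaton :: "('s, 'e) automaton \<Rightarrow> bool" where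
  "is_automaton A \<longleftrightarrow> finite (states A) \<and> finite (events A) \<and> events A \<noteq> {} \<and>
     (\<forall>q\<in>states A. \<forall>a\<in>events A. trans A q a \<subseteq> states A)"

definition eps_rel :: "('s, 'e) automaton \<Rightarrow> 'e set \<Rightarrow> ('s \<times> 's) set" where
  "eps_rel A Obs = {(q, r). q \<in> states A \<and> (\<exists>a \<in> events A - Obs. r \<in> trans A q a)}"

text \<open>Elimination of the \<open>\<epsilon>\<close>-transitions: a transition under an observable event may be
  preceded and followed by any number of \<open>\<epsilon>\<close>-transitions. As there are no distinguished initial
  and final states, both sides are needed for words from any \<open>s\<close> to any \<open>t\<close> to be preserved
  (up to projection).\<close>

definition proj_automaton :: "('s, 'e) automaton \<Rightarrow> 'e set \<Rightarrow> ('s, 'e) automaton" where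
  "proj_automaton A Obs =
     \<lparr> states = states A,
       events = Obs,
       trans = (\<lambda>q a. {r. \<exists>p p'. (q, p) \<in> (eps_rel A Obs)\<^sup>* \<and> p' \<in> trans A p a \<and>
                                 (p', r) \<in> (eps_rel A Obs)\<^sup>*}) \<rparr>"


section \<open>The semigroup of binary matrices\<close>

text \<open>Rows and columns are indexed by the states themselves; entries outside are \<open>0\<close>, so that
  two matrices are equal as functions iff they agree on all pairs of states.\<close>

type_synonym 's bmat = "'s \<Rightarrow> 's \<Rightarrow> nat"

definition event_matrix :: "('s, 'e) automaton \<Rightarrow> 'e \<Rightarrow> 's bmat" where
  "event_matrix A a =
     (\<lambda>i j. if i \<in> states A \<and> j \<in> states A \<and> j \<in> trans A i a then 1 else 0)"

definition bmat_mult :: "'s set \<Rightarrow> 's bmat \<Rightarrow> 's bmat \<Rightarrow> 's bmat" where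
  "bmat_mult Q U V =
     (\<lambda>i j. if i \<in> Q \<and> j \<in> Q then (MAX k\<in>Q. U i k * V k j) else 0)"

inductive_set semigroup_of :: "('s, 'e) automaton \<Rightarrow> 's bmat set"
  for A :: "('s, 'e) automaton" where
  generator: "a \<in> events A \<Longrightarrow> event_matrix A a \<in> semigroup_of A"
| product: "U \<in> semigroup_of A \<Longrightarrow> V \<in> semigroup_of A \<Longrightarrow>
     bmat_mult (states A) U V \<in> semigroup_of A"


section \<open>The semigroup-based verification algorithm and its running time\<close>

text \<open>The algorithm does not fix the order in which the elements of the semigroup are generated
  and in which the secret pairs are tested, so it is modelled as a nondeterministic transition
  system. \<open>Generate S\<close>: the elements of \<open>S\<close> have been processed. \<open>Test S W R\<close>: the
  newly generated element \<open>W\<close> still has to be tested against the secret pairs in \<open>R\<close>.\<close>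

datatype 's config =
    Start
  | Generate "'s bmat set"
  | Test "'s bmat set" "'s bmat" "('s \<times> 's) set"
  | Return bool

inductive alg_step ::
  "('s, 'e) automaton \<Rightarrow> 'e set \<Rightarrow> ('s \<times> 's) set \<Rightarrow> ('s \<times> 's) set \<Rightarrow>
     's config \<Rightarrow> 's config \<Rightarrow> bool"
  for A :: "('s, 'e) automaton" and Obs :: "'e set" and QS QNS :: "('s \<times> 's) set" where
  project: "alg_step A Obs QS QNS Start (Generate {})"
| new_element: "W \<in> semigroup_of (proj_automaton A Obs) \<Longrightarrow> W \<notin> S \<Longrightarrow>
    alg_step A Obs QS QNS (Generate S) (Test S W QS)"
| pair_bad: "(s, f) \<in> R \<Longrightarrow> W s f = 1 \<Longrightarrow> \<not> (\<exists>(s', f') \<in> QNS. W s' f' = 1) \<Longrightarrow>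
    alg_step A Obs QS QNS (Test S W R) (Return False)"
| pair_ok: "(s, f) \<in> R \<Longrightarrow> \<not> (W s f = 1 \<and> \<not> (\<exists>(s', f') \<in> QNS. W s' f' = 1)) \<Longrightarrow>
    alg_step A Obs QS QNS (Test S W R) (Test S W (R - {(s, f)}))"
| element_done: "alg_step A Obs QS QNS (Test S W {}) (Generate (insert W S))"
| all_done: "S = semigroup_of (proj_automaton A Obs) \<Longrightarrow>
    alg_step A Obs QS QNS (Generate S) (Return True)"

text \<open>\<open>alg_run A Obs QS QNS c t b\<close>: from configuration \<open>c\<close> the algorithm can return \<open>b\<close> after
  time \<open>t\<close>. The cost \<open>d\<close> of a step depends on the implementation (data structures, matrix
  multiplication, products yielding already known elements); it is only required that every
  step takes at least one unit of time.\<close>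

inductive alg_run ::
  "('s, 'e) automaton \<Rightarrow> 'e set \<Rightarrow> ('s \<times> 's) set \<Rightarrow> ('s \<times> 's) set \<Rightarrow>
     's config \<Rightarrow> nat \<Rightarrow> bool \<Rightarrow> bool"
  for A :: "('s, 'e) automaton" and Obs :: "'e set" and QS QNS :: "('s \<times> 's) set" where
  finished: "alg_run A Obs QS QNS (Return b) 0 b"
| step: "alg_step A Obs QS QNS c c' \<Longrightarrow> 1 \<le> d \<Longrightarrow> alg_run A Obs QS QNS c' t b \<Longrightarrow>
    alg_run A Obs QS QNS c (d + t) b"

text \<open>The time of the fastest possible execution; a lower bound on it is a lower bound on the
  running time of every implementation. If there were no terminating execution, the infimum
  would be \<open>0\<close>, hence lower bounds on \<open>alg_time\<close> are never vacuous.\<close>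

definition alg_time ::
  "('s, 'e) automaton \<Rightarrow> 'e set \<Rightarrow> ('s \<times> 's) set \<Rightarrow> ('s \<times> 's) set \<Rightarrow> nat" where
  "alg_time A Obs QS QNS = Inf {t. \<exists>b. alg_run A Obs QS QNS Start t b}"

lemma alg_run_result:
  assumes "alg_run A Obs QS QNS Start t b"
  shows "b \<longleftrightarrow> (\<forall>W \<in> semigroup_of (proj_automaton A Obs). \<forall>(s, f) \<in> QS.
           W s f = 1 \<longrightarrow> (\<exists>(s', f') \<in> QNS. W s' f' = 1))"
proof -
  define B where "B = semigroup_of (proj_automaton A Obs)"
  define ok where "ok W p \<longleftrightarrow> (W (fst p) (snd p) = (1::nat) \<longrightarrow> (\<exists>(s', f') \<in> QNS. W s' f' = 1))"
    for W and p :: "'a \<times> 'a"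
  define inv where "inv c \<longleftrightarrow> (case c of Start \<Rightarrow> True
      | Generate S \<Rightarrow> (\<forall>W\<in>S. \<forall>p\<in>QS. ok W p)
      | Test S W R \<Rightarrow> (\<forall>W\<in>S. \<forall>p\<in>QS. ok W p) \<and> W \<in> B \<and> R \<subseteq> QS \<and> (\<forall>p\<in>QS - R. ok W p)
      | Return b \<Rightarrow> (b \<longleftrightarrow> (\<forall>W\<in>B. \<forall>p\<in>QS. ok W p)))" for c
  have inv_step: "inv c'" if "alg_step A Obs QS QNS c c'" "inv c" for c c'
    using that
  proof cases
    case (pair_bad s f R W S)
    then have "\<not> ok W (s, f)" "(s, f) \<in> QS" "W \<in> B"
      using that(2) by (auto simp: inv_def ok_def)
    then show ?thesis
      using pair_bad by (auto simp: inv_def)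
  next
    case (pair_ok s f R W S)
    then have "ok W (s, f)"
      by (auto simp: ok_def)
    then show ?thesis
      using pair_ok that(2) by (auto simp: inv_def)
  qed (auto simp: inv_def B_def)
  have "inv c \<Longrightarrow> b \<longleftrightarrow> (\<forall>W\<in>B. \<forall>p\<in>QS. ok W p)" if "alg_run A Obs QS QNS c t b" for c t b
    using that by induction (use inv_step in \<open>auto simp: inv_def\<close>)
  from this[OF assms] show ?thesis
    unfolding B_def ok_def inv_def by (simp add: case_prod_unfold)
qed

end

theory Submission imports Defs begin

text \<open>
  With \<open>Q\<^sub>S = Q\<^sub>N\<^sub>S = Q \<times> Q\<close> the algorithm never returns \<open>False\<close>, so it performs \<open>n\<^sup>2\<close> tests on each
  element of the semigroup. For \<open>n = 2k + 1\<close>, split the states into a part \<open>X\<close> of size \<open>k\<close> and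
  a part \<open>Y\<close> of size \<open>k + 1\<close>. One event rotates \<open>X\<close> and \<open>Y\<close> cyclically, the other one is the identity
  with one additional edge from \<open>X\<close> to \<open>Y\<close>. Because \<open>k\<close> and \<open>k + 1\<close> are coprime, the powers of the
  rotation move this edge to every pair in \<open>X \<times> Y\<close>, and multiplying the resulting conjugates yields
  the identity extended by an arbitrary subset of \<open>X \<times> Y\<close>. There are \<open>2\<^bsup>k(k+1)\<^esup>\<close> of these.
\<close>

section \<open>Binary matrices as relations\<close>

text \<open>Under this encoding the boolean product becomes relational composition \<open>O\<close>,
  so the later arguments handle sets of edges.\<close>

definition rel_mat :: "('s \<times> 's) set \<Rightarrow> 's bmat" where
  "rel_mat R = (\<lambda>i j. of_bool ((i, j) \<in> R))"

lemma rel_mat_eq_iff [simp]: "rel_mat R = rel_mat R' \<longleftrightarrow> R = R'"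
  by (auto simp: rel_mat_def fun_eq_iff of_bool_def split: if_splits)

lemma event_matrix_eq_rel_mat:
  "event_matrix A a = rel_mat {(i, j). i \<in> states A \<and> j \<in> states A \<and> j \<in> trans A i a}"
  by (auto simp: event_matrix_def rel_mat_def fun_eq_iff)

text \<open>Every term of the maximum is \<open>0\<close> or \<open>1\<close>, and a
  \<open>1\<close> occurs exactly when some intermediate state links \<open>i\<close> to
  \<open>j\<close>; that state lies in \<open>Q\<close> because both relations live on
  \<open>Q\<close>.\<close>

lemma bmat_mult_rel_mat:
  assumes "finite Q" "R \<subseteq> Q \<times> Q" "R' \<subseteq> Q \<times> Q"
  shows "bmat_mult Q (rel_mat R) (rel_mat R') = rel_mat (R O R')"
proof (intro ext)
  fix i j
  show "bmat_mult Q (rel_mat R) (rel_mat R') i j = rel_mat (R O R') i j"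
  proof (cases "i \<in> Q \<and> j \<in> Q")
    case True
    let ?f = "\<lambda>k. rel_mat R i k * rel_mat R' k j"
    have fin: "finite (?f ` Q)" "?f ` Q \<noteq> {}"
      using assms(1) True by auto
    show ?thesis
    proof (cases "(i, j) \<in> R O R'")
      case rel: True
      then obtain k where "(i, k) \<in> R" "(k, j) \<in> R'" by blast
      then have "1 \<in> ?f ` Q"
        using assms(2) by (force simp: rel_mat_def)
      moreover have "?f k \<le> 1" for k
        by (simp add: rel_mat_def of_bool_def)
      ultimately have "Max (?f ` Q) = 1"
        using fin(1) by (intro Max_eqI) blast+
      then show ?thesis
        using True rel by (simp add: bmat_mult_def rel_mat_def)
    next
      case False
      then have "?f k = 0" for k
        by (auto simp: rel_mat_def)
      then have "?f ` Q = {0}"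
        using fin(2) by auto
      then show ?thesis
        using True False by (simp add: bmat_mult_def rel_mat_def)
    qed
  next
    case False
    then show ?thesis
      using assms by (auto simp: bmat_mult_def rel_mat_def)
  qed
qed

text \<open>All products stay among the matrices of relations on the finite state set.\<close>

lemma finite_semigroup_of:
  assumes "finite (states A)"
  shows "finite (semigroup_of A)"
proof (rule finite_subset)
  show "semigroup_of A \<subseteq> rel_mat ` Pow (states A \<times> states A)"
  proof
    fix W assume "W \<in> semigroup_of A"
    then show "W \<in> rel_mat ` Pow (states A \<times> states A)"
    proof induction
      case (generator a)
      then show ?case
        unfolding event_matrix_eq_rel_mat by (intro imageI) auto
    next
      case (product U V)
      then obtain R R' where "U = rel_mat R" "R \<subseteq> states A \<times> states A"
        "V = rel_mat R'" "R' \<subseteq> states A \<times> states A" by auto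
      moreover from this have "R O R' \<subseteq> states A \<times> states A" by blast
      ultimately show ?case
        using bmat_mult_rel_mat[OF assms] by auto
    qed
  qed
  show "finite (rel_mat ` Pow (states A \<times> states A))"
    using assms by simp
qed

lemma semigroup_of_mono:
  assumes "states A = states B" "events A \<subseteq> events B" "event_matrix A = event_matrix B"
  shows "semigroup_of A \<subseteq> semigroup_of B"
proof
  fix W assume "W \<in> semigroup_of A"
  then show "W \<in> semigroup_of B"
    by induction (use assms semigroup_of.intros[of _ B] in auto)
qed

text \<open>With every event observable, \<open>eps_rel\<close> is empty and its closure is the
  identity, so the elimination changes no matrix.\<close>

lemma semigroup_of_proj_automaton_all_observable:
  "semigroup_of (proj_automaton A (events A)) = semigroup_of A"
proof -
  have "eps_rel A (events A) = {}"
    by (auto simp: eps_rel_def)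
  then have "event_matrix (proj_automaton A (events A)) = event_matrix A"
    by (auto simp: proj_automaton_def event_matrix_def fun_eq_iff)
  moreover have "states (proj_automaton A (events A)) = states A"
    "events (proj_automaton A (events A)) = events A"
    by (simp_all add: proj_automaton_def)
  ultimately show ?thesis
    by (intro equalityI semigroup_of_mono) simp_all
qed

section \<open>Running time of the algorithm\<close>

text \<open>Rules out the default value \<open>0\<close> of an infimum over the empty set. Two
  nested descents give termination: on the pairs still to be tested and on the elements still to be
  generated.\<close>

lemma alg_run_exists:
  assumes "finite QS" "finite (semigroup_of (proj_automaton A Obs))"
  shows "\<exists>t b. alg_run A Obs QS QNS Start t b"
proof -
  let ?B = "semigroup_of (proj_automaton A Obs)"
  define terminates where "terminates c \<longleftrightarrow> (\<exists>t b. alg_run A Obs QS QNS c t b)" for c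
  have step: "terminates c" if "alg_step A Obs QS QNS c c'" "terminates c'" for c c'
    using that alg_run.step[OF that(1) order_refl] unfolding terminates_def by blast
  have return: "terminates (Return b)" for b
    unfolding terminates_def using alg_run.finished by blast
  have test: "terminates (Test S W R)"
    if "finite R" "terminates (Generate (insert W S))" for S W R
    using that(1)
  proof (induction R rule: finite_psubset_induct)
    case (psubset R)
    show ?case
    proof (cases "R = {}")
      case True
      then show ?thesis
        using step[OF alg_step.element_done that(2)] by simp
    next
      case False
      then obtain s f where p: "(s, f) \<in> R" by auto
      then have "terminates (Test S W (R - {(s, f)}))"
        by (intro psubset.IH) auto
      then show ?thesis
        using step[OF alg_step.pair_ok[OF p]] step[OF alg_step.pair_bad[OF p]] return by blast
    qed
  qed
  have "terminates (Generate S)" if "S \<subseteq> ?B" for S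
    using that
  proof (induction "card (?B - S)" arbitrary: S rule: less_induct)
    case less
    show ?case
    proof (cases "S = ?B")
      case True
      then show ?thesis
        using step[OF alg_step.all_done return] by blast
    next
      case False
      then obtain W where W: "W \<in> ?B" "W \<notin> S"
        using less.prems by blast
      then have "card (?B - insert W S) < card (?B - S)"
        using assms(2) by (intro psubset_card_mono) auto
      then have "terminates (Generate (insert W S))"
        using less W by blast
      then show ?thesis
        using step[OF alg_step.new_element[OF W]] test[OF assms(1)] by blast
    qed
  qed
  then show ?thesis
    using step[OF alg_step.project] unfolding terminates_def by blast
qed

text \<open>A potential argument: \<open>remaining\<close> counts the tests still owed, and a step
  of cost at least one lowers it by at most one. \<open>Return False\<close> cannot occur, since a
  secret pair with entry \<open>1\<close> is its own nonsecret witness.\<close>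

lemma alg_run_time_ge:
  assumes "finite QS" "finite (semigroup_of (proj_automaton A Obs))" "QS \<subseteq> QNS"
    and "alg_run A Obs QS QNS Start t b"
  shows "card (semigroup_of (proj_automaton A Obs)) * card QS \<le> t"
proof -
  let ?B = "semigroup_of (proj_automaton A Obs)"
  define remaining where "remaining c = (case c of
      Start \<Rightarrow> card ?B * card QS
    | Generate S \<Rightarrow> card (?B - S) * card QS
    | Test S W R \<Rightarrow> card R + card (?B - insert W S) * card QS
    | Return b \<Rightarrow> 0)" for c
  \<comment> \<open>\<open>R \<subseteq> QS\<close> makes \<open>R\<close> finite, so that a test
    lowers \<open>card R\<close> by exactly one, and it puts each tested pair into
    \<open>QNS\<close>.\<close>
  define valid where "valid c \<longleftrightarrow> (case c of Test S W R \<Rightarrow> R \<subseteq> QS | _ \<Rightarrow> True)" for c :: "'a config"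
  have valid_step: "valid c' \<and> remaining c \<le> 1 + remaining c'"
    if "alg_step A Obs QS QNS c c'" "valid c" for c c'
    using that
  proof cases
    case (new_element W S)
    then have "card (?B - S) = Suc (card (?B - insert W S))"
      using assms(2) card_Suc_Diff1[of "?B - S" W] by (simp add: Diff_insert[of _ W S])
    then show ?thesis
      using new_element by (simp add: valid_def remaining_def del: card_Diff_insert)
  next
    case (pair_bad s f R W S)
    then have "(s, f) \<in> QNS"
      using that(2) assms(3) by (auto simp: valid_def)
    then show ?thesis
      using pair_bad by blast
  next
    case (pair_ok s f R W S)
    then have "R \<subseteq> QS"
      using that(2) by (simp add: valid_def)
    then have "card R = Suc (card (R - {(s, f)}))"
      using pair_ok assms(1) by (metis card_Suc_Diff1 finite_subset)
    then show ?thesis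
      using pair_ok \<open>R \<subseteq> QS\<close> by (auto simp: valid_def remaining_def)
  qed (auto simp: valid_def remaining_def)
  have "valid c \<Longrightarrow> remaining c \<le> t" if "alg_run A Obs QS QNS c t b" for c t b
    using that
  proof induction
    case (finished b)
    then show ?case by (simp add: remaining_def)
  next
    case (step c c' d t b)
    then show ?case
      using valid_step[OF step.hyps(1)] by linarith
  qed
  from this[OF assms(4)] show ?thesis
    by (simp add: valid_def remaining_def)
qed

lemma alg_time_ge:
  assumes "finite QS" "finite (semigroup_of (proj_automaton A Obs))" "QS \<subseteq> QNS"
  shows "card (semigroup_of (proj_automaton A Obs)) * card QS \<le> alg_time A Obs QS QNS"
proof -
  have "{t. \<exists>b. alg_run A Obs QS QNS Start t b} \<noteq> {}"
    using alg_run_exists[OF assms(1,2)] by blast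
  then show ?thesis
    unfolding alg_time_def by (rule cInf_greatest) (use alg_run_time_ge[OF assms] in blast)
qed

section \<open>An automaton with a large semigroup\<close>

definition rot :: "nat \<Rightarrow> nat \<Rightarrow> nat \<Rightarrow> nat" where
  "rot k t q = (if q < k then (q + t) mod k else k + (q - k + t) mod (k + 1))"

definition two_cycles :: "nat \<Rightarrow> (nat, nat) automaton" where
  "two_cycles k =
     \<lparr> states = {..<2 * k + 1},
       events = {0, 1},
       trans = (\<lambda>q a. if a = 0 then {rot k 1 q} else if q = 0 then {0, k} else {q}) \<rparr>"

lemma rot_less: "q < 2 * k + 1 \<Longrightarrow> rot k t q < 2 * k + 1"
  using mod_less_divisor[of k "q + t"] mod_less_divisor[of "k + 1" "q - k + t"]
  by (cases "q < k") (simp_all add: rot_def del: mod_less_divisor)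

lemma rot_0 [simp]: "q < 2 * k + 1 \<Longrightarrow> rot k 0 q = q"
  by (simp add: rot_def)

lemma rot_less_iff [simp]: "rot k t q < k \<longleftrightarrow> q < k"
  by (simp add: rot_def)

lemma rot_rot: "rot k t (rot k s q) = rot k (s + t) q"
  by (simp add: rot_def mod_simps add.assoc)

text \<open>\<open>k * (k + 1)\<close> is a common multiple of the two cycle lengths.\<close>

lemma rot_period:
  assumes "q < 2 * k + 1"
  shows "rot k (k * (k + 1) * m) q = q"
proof (cases "q < k")
  case True
  have "(q + k * ((k + 1) * m)) mod k = q mod k"
    by (rule mod_mult_self2)
  then show ?thesis
    using True by (simp only: rot_def if_True mult.assoc mod_less)
next
  case False
  have "(q - k + (k + 1) * (k * m)) mod (k + 1) = (q - k) mod (k + 1)"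
    by (rule mod_mult_self2)
  also have "\<dots> = q - k"
    using assms by (intro mod_less) simp
  finally have "rot k ((k + 1) * (k * m)) q = k + (q - k)"
    using False by (simp only: rot_def if_False)
  then show ?thesis
    using False by (simp only: mult.assoc mult.left_commute not_less le_add_diff_inverse)
qed

lemma inj_on_rot: "inj_on (rot k t) {..<2 * k + 1}"
proof (cases "k = 0")
  case False
  show ?thesis
  proof (rule inj_on_inverseI)
    fix q assume "q \<in> {..<2 * k + 1}"
    \<comment> \<open>Completing \<open>t\<close> to a multiple of the period undoes the rotation;
      the truncated subtraction is exact because \<open>k\<close> is positive.\<close>
    moreover have "t + (k * (k + 1) * t - t) = k * (k + 1) * t"
      using False by (simp add: le_add_diff_inverse)
    ultimately show "rot k (k * (k + 1) * t - t) (rot k t q) = q"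
      by (simp only: rot_rot rot_period lessThan_iff)
  qed
qed (simp add: lessThan_Suc)

text \<open>The Chinese remainder theorem for the moduli \<open>k\<close> and \<open>k + 1\<close>, solved explicitly.\<close>

lemma rot_transitive:
  assumes "x < k" "k \<le> y" "y < 2 * k + 1"
  obtains t where "t \<ge> t0" "rot k t x = 0" "rot k t y = k"
proof
  \<comment> \<open>Modulo \<open>k + 1\<close>, \<open>k\<close> is \<open>-1\<close>, so
    \<open>?t\<close> is \<open>-(y - k)\<close>; modulo \<open>k\<close>, \<open>?t\<close> is
    \<open>d\<close>, which is \<open>-x\<close>. The summand \<open>k * t0\<close> only makes
    \<open>?t\<close> large enough.\<close>
  define d where "d = (k - 1) * x + k * t0"
  let ?t = "(y - k) * k + (k + 1) * d"
  have k: "k > 0" using assms by simp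
  have "t0 \<le> k * t0" using k by simp
  also have "\<dots> \<le> d" by (simp add: d_def)
  also have "\<dots> \<le> (k + 1) * d" by simp
  finally show "t0 \<le> ?t" by simp
  have "x + d = k * (x + t0)"
    using k by (cases k) (simp_all add: d_def algebra_simps)
  then have "x + ?t = k * (y - k + d + (x + t0))"
    by (simp add: algebra_simps)
  then show "rot k ?t x = 0"
    using assms by (simp add: rot_def)
  \<comment> \<open>A general \<open>w\<close> in place of \<open>y - k\<close> keeps truncated
    subtraction out of the algebra.\<close>
  have "w + (w * k + (k + 1) * d) = (k + 1) * (w + d)" for w
    by (simp add: algebra_simps)
  then have "y - k + ?t = (k + 1) * (y - k + d)" .
  then have "(y - k + ?t) mod (k + 1) = 0"
    by (simp only: mod_mult_self1_is_0)
  then show "rot k ?t y = k"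
    using assms by (simp add: rot_def)
qed

lemma is_automaton_two_cycles: "is_automaton (two_cycles k)"
proof -
  have "trans (two_cycles k) q a \<subseteq> states (two_cycles k)" if "q \<in> states (two_cycles k)" for q a
    using rot_less[of q k 1] that by (simp add: two_cycles_def)
  then show ?thesis
    by (simp add: is_automaton_def) (simp add: two_cycles_def)
qed

text \<open>The identity extended by the edges \<open>S\<close>, followed by \<open>t\<close> rotations. Keeping \<open>t\<close> as a
  parameter avoids inverses: the additional edge is inserted into \<open>S\<close> at a suitable \<open>t\<close>.\<close>

definition ext_rot :: "nat \<Rightarrow> nat \<Rightarrow> (nat \<times> nat) set \<Rightarrow> (nat \<times> nat) set" where
  "ext_rot k t S = {(i, rot k t y) |i y. i < 2 * k + 1 \<and> y < 2 * k + 1 \<and> (y = i \<or> (i, y) \<in> S)}"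

lemma ext_rot_subset: "ext_rot k t S \<subseteq> {..<2 * k + 1} \<times> {..<2 * k + 1}"
  using rot_less by (auto simp: ext_rot_def)

lemma ext_rot_0:
  assumes "S \<subseteq> {..<2 * k + 1} \<times> {..<2 * k + 1}"
  shows "ext_rot k 0 S = Id_on {..<2 * k + 1} \<union> S"
proof -
  have "ext_rot k 0 S = {(i, y). i < 2 * k + 1 \<and> y < 2 * k + 1 \<and> (y = i \<or> (i, y) \<in> S)}"
    unfolding ext_rot_def using rot_0 by force
  then show ?thesis
    using assms by auto
qed

lemma ext_rot_cong:
  assumes "\<And>q. q < 2 * k + 1 \<Longrightarrow> rot k t q = rot k s q"
  shows "ext_rot k t S = ext_rot k s S"
  unfolding ext_rot_def by (intro Collect_cong ex_cong1) (use assms in auto)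

lemma ext_rot_mult_rotation:
  "ext_rot k t S O ext_rot k s {} = ext_rot k (t + s) S"
  using rot_less[of _ k t] by (force simp: ext_rot_def rot_rot)

text \<open>After \<open>t\<close> rotations \<open>x\<close> sits at \<open>0\<close> and
  \<open>y\<close> at \<open>k\<close>, so the edge from \<open>0\<close> to \<open>k\<close> acts
  as an edge from \<open>x\<close> to \<open>y\<close>.\<close>

lemma ext_rot_mult_edge:
  assumes S: "S \<subseteq> {..<k} \<times> {k..<2 * k + 1}"
    and x: "x < k" and y: "k \<le> y" "y < 2 * k + 1"
    and t: "rot k t x = 0" "rot k t y = k"
  shows "ext_rot k t S O ext_rot k 0 {(0, k)} = ext_rot k t (insert (x, y) S)"
proof -
  have preimage: "rot k t q = 0 \<longleftrightarrow> q = x" if "q < 2 * k + 1" for q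
    using inj_onD[OF inj_on_rot[of k t], of q x] that x t by auto
  have edge: "ext_rot k 0 {(0, k)} = insert (0, k) (Id_on {..<2 * k + 1})"
    using ext_rot_0[of "{(0, k)}" k] by simp
  show ?thesis
  proof (rule equalityI; rule subrelI)
    fix i j assume "(i, j) \<in> ext_rot k t S O ext_rot k 0 {(0, k)}"
    then obtain q where q: "i < 2 * k + 1" "q < 2 * k + 1" "q = i \<or> (i, q) \<in> S"
      "j = rot k t q \<or> rot k t q = 0 \<and> j = k"
      unfolding edge by (auto simp: ext_rot_def)
    show "(i, j) \<in> ext_rot k t (insert (x, y) S)"
    proof (cases "j = rot k t q")
      case True
      then show ?thesis using q by (auto simp: ext_rot_def)
    next
      case False
      then have "q = x" "j = rot k t y"
        using q preimage t by auto
      \<comment> \<open>Edges of \<open>S\<close> end in the long cycle, never in \<open>x\<close>;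
        hence the new edge cannot be chained after one of them.\<close>
      moreover have "i = x"
        using S q x \<open>q = x\<close> by auto
      ultimately show ?thesis
        using q y by (auto simp: ext_rot_def)
    qed
  next
    fix i j assume "(i, j) \<in> ext_rot k t (insert (x, y) S)"
    then obtain q where q: "i < 2 * k + 1" "q < 2 * k + 1" "j = rot k t q"
      "q = i \<or> (i, q) \<in> S \<or> (i, q) = (x, y)"
      by (auto simp: ext_rot_def)
    show "(i, j) \<in> ext_rot k t S O ext_rot k 0 {(0, k)}"
    proof (cases "(i, q) = (x, y)")
      case True
      then have "(i, 0) \<in> ext_rot k t S"
        using x t by (force simp: ext_rot_def)
      then show ?thesis
        using True q t unfolding edge by auto
    next
      case False
      then have "(i, j) \<in> ext_rot k t S"
        using q by (auto simp: ext_rot_def)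
      moreover have "(j, j) \<in> ext_rot k 0 {(0, k)}"
        using q rot_less unfolding edge by auto
      ultimately show ?thesis by blast
    qed
  qed
qed

section \<open>Elements of the semigroup of \<open>two_cycles\<close>\<close>

lemma event_matrix_two_cycles:
  "event_matrix (two_cycles k) 0 = rel_mat (ext_rot k 1 {})"
  "event_matrix (two_cycles k) 1 = rel_mat (ext_rot k 0 {(0, k)})"
proof -
  show "event_matrix (two_cycles k) 0 = rel_mat (ext_rot k 1 {})"
    using rot_less[of _ k 1]
    by (auto simp: event_matrix_eq_rel_mat two_cycles_def ext_rot_def)
  show "event_matrix (two_cycles k) 1 = rel_mat (ext_rot k 0 {(0, k)})"
  proof -
    have "{(i, j). i < 2 * k + 1 \<and> j < 2 * k + 1 \<and> j \<in> (if i = 0 then {0, k} else {i})}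
        = Id_on {..<2 * k + 1} \<union> {(0, k)}"
      by (auto split: if_splits)
    also have "\<dots> = ext_rot k 0 {(0, k)}"
      by (rule ext_rot_0[symmetric]) simp
    finally show ?thesis
      by (simp add: event_matrix_eq_rel_mat two_cycles_def)
  qed
qed

lemma semigroup_two_cycles_mult:
  assumes "rel_mat (ext_rot k t S) \<in> semigroup_of (two_cycles k)"
    and "rel_mat (ext_rot k s S') \<in> semigroup_of (two_cycles k)"
  shows "rel_mat (ext_rot k t S O ext_rot k s S') \<in> semigroup_of (two_cycles k)"
proof -
  have "bmat_mult (states (two_cycles k)) (rel_mat (ext_rot k t S)) (rel_mat (ext_rot k s S'))
      \<in> semigroup_of (two_cycles k)"
    using assms by (rule semigroup_of.product)
  then show ?thesis
    by (simp add: two_cycles_def bmat_mult_rel_mat ext_rot_subset del: One_nat_def)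
qed

text \<open>Multiplying by the rotation only increases \<open>t\<close>, which is why
  \<open>rot_transitive\<close> offers arbitrarily large \<open>t\<close>.\<close>

lemma semigroup_two_cycles_rotate:
  assumes "rel_mat (ext_rot k t S) \<in> semigroup_of (two_cycles k)" "t \<le> t'"
  shows "rel_mat (ext_rot k t' S) \<in> semigroup_of (two_cycles k)"
  using assms(2)
proof (induction t' rule: dec_induct)
  case base
  show ?case by fact
next
  case (step t')
  have "event_matrix (two_cycles k) 0 \<in> semigroup_of (two_cycles k)"
    by (rule semigroup_of.generator) (simp add: two_cycles_def)
  then show ?case
    using semigroup_two_cycles_mult[OF step.IH, of 1 "{}"]
    by (simp add: event_matrix_two_cycles ext_rot_mult_rotation)
qed

text \<open>Edges are inserted one at a time, rotating onward before each insertion; the empty set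
  starts from the rotation itself.\<close>

lemma semigroup_two_cycles_ext:
  assumes "S \<subseteq> {..<k} \<times> {k..<2 * k + 1}"
  shows "\<exists>t. rel_mat (ext_rot k t S) \<in> semigroup_of (two_cycles k)"
proof -
  have gen: "event_matrix (two_cycles k) a \<in> semigroup_of (two_cycles k)" if "a \<in> {0, 1}" for a
    by (rule semigroup_of.generator) (use that in \<open>simp add: two_cycles_def\<close>)
  have "finite S"
    using assms by (rule finite_subset) simp
  then show ?thesis
    using assms
  proof (induction S rule: finite_induct)
    case empty
    then show ?case
      using gen[of 0] by (auto simp: event_matrix_two_cycles)
  next
    case (insert p S)
    then obtain x y where p: "p = (x, y)" "x < k" "k \<le> y" "y < 2 * k + 1"
      by auto
    from insert obtain t0 where t0: "rel_mat (ext_rot k t0 S) \<in> semigroup_of (two_cycles k)"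
      by auto
    obtain t where t: "t \<ge> t0" "rot k t x = 0" "rot k t y = k"
      using rot_transitive p by blast
    have "rel_mat (ext_rot k t S O ext_rot k 0 {(0, k)}) \<in> semigroup_of (two_cycles k)"
      using semigroup_two_cycles_rotate[OF t0 t(1)] gen[of 1]
      by (intro semigroup_two_cycles_mult) (simp_all add: event_matrix_two_cycles[unfolded One_nat_def])
    then show ?case
      using ext_rot_mult_edge[OF _ p(2-4) t(2,3), of S] insert.prems p(1) by auto
  qed
qed

text \<open>Rotating on to a multiple of the period brings every \<open>S\<close> to the common
  offset \<open>0\<close>, where different \<open>S\<close> give different matrices.\<close>

lemma card_semigroup_two_cycles:
  assumes "k > 0"
  shows "2 ^ (k * (k + 1)) \<le> card (semigroup_of (two_cycles k))"
proof -
  let ?E = "{..<k} \<times> {k..<2 * k + 1}" and ?f = "\<lambda>S. rel_mat (ext_rot k 0 S)"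
  have "?f S \<in> semigroup_of (two_cycles k)" if "S \<subseteq> ?E" for S
  proof -
    obtain t where "rel_mat (ext_rot k t S) \<in> semigroup_of (two_cycles k)"
      using semigroup_two_cycles_ext[OF \<open>S \<subseteq> ?E\<close>] by blast
    moreover have "t \<le> k * (k + 1) * t"
      using assms by simp
    ultimately have "rel_mat (ext_rot k (k * (k + 1) * t) S) \<in> semigroup_of (two_cycles k)"
      by (rule semigroup_two_cycles_rotate)
    also have "ext_rot k (k * (k + 1) * t) S = ext_rot k 0 S"
      by (rule ext_rot_cong) (simp only: rot_period rot_0)
    finally show ?thesis .
  qed
  moreover have "inj_on ?f (Pow ?E)"
  proof (rule inj_on_inverseI)
    fix S assume S: "S \<in> Pow ?E"
    then have "ext_rot k 0 S = Id_on {..<2 * k + 1} \<union> S"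
      by (intro ext_rot_0) auto
    \<comment> \<open>\<open>?E\<close> contains no diagonal pair, so restricting to it recovers
      \<open>S\<close>.\<close>
    then show "{(i, j) \<in> ?E. ?f S i j = 1} = S"
      using S by (auto simp: rel_mat_def of_bool_def split: if_splits)
  qed
  moreover have "finite (semigroup_of (two_cycles k))"
    using is_automaton_two_cycles by (intro finite_semigroup_of) (simp add: is_automaton_def)
  ultimately have "card (Pow ?E) \<le> card (semigroup_of (two_cycles k))"
    by (intro card_inj_on_le) auto
  then show ?thesis
    by (simp add: card_Pow card_cartesian_product)
qed

theorem corollary2:
  "\<exists>(A :: nat \<Rightarrow> (nat, nat) automaton) Obs QS QNS.
     (\<forall>n. odd n \<longrightarrow>
        is_automaton (A n) \<and> card (states (A n)) = n \<and>
        Obs n \<subseteq> events (A n) \<and> card (Obs n) = 2 \<and>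
        QS n \<subseteq> states (A n) \<times> states (A n) \<and>
        QNS n \<subseteq> states (A n) \<times> states (A n)) \<and>
     (\<lambda>n. real (alg_time (A n) (Obs n) (QS n) (QNS n)))
       \<in> \<Omega>[inf at_top (principal {n. odd n})](\<lambda>n. (real n)\<^sup>2 * 2 powr (((real n)\<^sup>2 - 1) / 4))"
proof -
  define A where "A n = two_cycles (n div 2)" for n
  define pairs where "pairs n = states (A n) \<times> states (A n)" for n
  have states: "states (A n) = {..<n}" if "odd n" for n
    using that by (auto simp: A_def two_cycles_def elim!: oddE)
  \<comment> \<open>\<open>n > 1\<close> gives \<open>k > 0\<close> for the cardinality bound and is
    harmless asymptotically.\<close>
  have time: "(real n)\<^sup>2 * 2 powr (((real n)\<^sup>2 - 1) / 4)
      \<le> real (alg_time (A n) (events (A n)) (pairs n) (pairs n))" if "odd n" "n > 1" for n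
  proof -
    from \<open>odd n\<close> obtain k where k: "n = 2 * k + 1" by (elim oddE)
    \<comment> \<open>The exponent is the number of pairs in \<open>X \<times> Y\<close>, a natural
      number, so \<open>powr\<close> becomes an ordinary power.\<close>
    have "((real n)\<^sup>2 - 1) / 4 = real (k * (k + 1))"
      by (simp add: k power2_eq_square field_simps)
    then have "(real n)\<^sup>2 * 2 powr (((real n)\<^sup>2 - 1) / 4) = real (2 ^ (k * (k + 1)) * n\<^sup>2)"
      by (simp only: powr_realpow) simp
    also have "2 ^ (k * (k + 1)) * n\<^sup>2 \<le> card (semigroup_of (A n)) * n\<^sup>2"
      using card_semigroup_two_cycles[of k] that by (intro mult_right_mono) (auto simp: A_def k)
    also have "n\<^sup>2 = card (pairs n)"
      using states[OF \<open>odd n\<close>] by (simp add: pairs_def card_cartesian_product power2_eq_square)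
    also have "card (semigroup_of (A n)) * card (pairs n)
        \<le> alg_time (A n) (events (A n)) (pairs n) (pairs n)"
      using alg_time_ge[of "pairs n" "A n" "events (A n)" "pairs n"] states[OF \<open>odd n\<close>]
      by (simp add: semigroup_of_proj_automaton_all_observable finite_semigroup_of pairs_def)
    finally show ?thesis by simp
  qed
  have "(\<lambda>n. real (alg_time (A n) (events (A n)) (pairs n) (pairs n)))
       \<in> \<Omega>[inf at_top (principal {n. odd n})](\<lambda>n. (real n)\<^sup>2 * 2 powr (((real n)\<^sup>2 - 1) / 4))"
  proof (rule landau_omega.bigI[of 1])
    show "\<forall>\<^sub>F n in inf at_top (principal {n. odd n}).
        norm (real (alg_time (A n) (events (A n)) (pairs n) (pairs n)))
        \<ge> 1 * norm ((real n)\<^sup>2 * 2 powr (((real n)\<^sup>2 - 1) / 4))"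
      unfolding eventually_inf_principal
      using eventually_gt_at_top[of "1::nat"]
      by eventually_elim (use time in simp)
  qed simp
  moreover have "is_automaton (A n)" "card (events (A n)) = 2" for n
    using is_automaton_two_cycles by (simp_all add: A_def two_cycles_def)
  ultimately show ?thesis
    using states
    by (intro exI[of _ A] exI[of _ "\<lambda>n. events (A n)"] exI[of _ pairs]) (auto simp: pairs_def)
qed

end
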